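(* Let $q=\infty$. For every $\delta\in(0,1]$ and $\epsilon\in(0,1]$, the process $Z_n$ with parameters $(\delta,\epsilon)$ is ergodic.
   Context: Let $V=\{(x,t)\in\mathbb{Z}^2 : x+t \text{ even}\}$, and let $\delta,\epsilon\in[0,1]$. Let $(X(v))_{v\in V}$ be i.i.d. with values in the set of symbols $\{\nwarrow,\ \nearrow,\ \nwarrow\nearrow,\ \odot\}$ and $$P(X(v)=\nwarrow)=P(X(v)=\nearrow)=\tfrac12(1-\delta),\quad P(X(v)=\nwarrow\nearrow)=\delta(1-\epsilon),\quad P(X(v)=\odot)=\delta\epsilon .$$ For $v=(x,t)$ write $v_l=(x-1,t+1)$ and $v_r=(x+1,t+1)$. Row $n$ ($n\ge 0$) is the set of vertices $(x,-n)\in V$, so time $n$ runs downwards. The case $q=\infty$: the state $Z_n$ at time $n$ is a partition of row $n$ into equivalence classes, which play the role of colors (two vertices "have the same color" iff they are in the same class). The initial partition of row $0$ has an arbitrary distribution, independent of the $X(v)$'s. Given the partition of row $n-1$, the partition of row $n\ge 1$ is determined by the following rule for each vertex $v$ in row $n$: if $X(v)=\nwarrow$, $v$ takes the color of $v_l$; if $X(v)=\nearrow$, $v$ takes the color of $v_r$; if $X(v)=\nwarrow\nearrow$ and $v_l,v_r$ have the same color, $v$ takes this common color; if $X(v)=\odot$, or if $X(v)=\nwarrow\nearrow$ and $v_l,v_r$ have different colors, $v$ is given a completely new color, different from all previously existing ones and from the color of every other vertex of row $n$. Two vertices of row $n$ are in the same class iff they receive the same color. Row $n$ is identified with $\mathbb{Z}$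 via $(x,-n)\mapsto (x+n)/2$, so that $Z_n$ is a time-homogeneous discrete-time Markov process on the space of partitions (equivalence relations) of $\mathbb{Z}$, viewed as a closed subset of $\{0,1\}^{\mathbb{Z}\times\mathbb{Z}}$ with the product topology. The process is called ergodic if it has a unique invariant distribution and, for every initial distribution, the law of $Z_n$ converges weakly to it as $n\to\infty$ (equivalently, the law of the partition induced on each finite interval converges). *)

theory Defs
  imports "HOL-Probability.Probability"
begin

datatype symbol = UpLeft | UpRight | UpBoth | Erase

instance symbol :: countable
  by countable_datatype

lemma UNIV_symbol: "UNIV = {UpLeft, UpRight, UpBoth, Erase}"
  using symbol.exhaust by auto

text \<open>The function passed to \<^const>\<open>embed_pmf\<close> is a probability mass function when both parameters
  lie in the unit interval; see \<open>pmf_symbol_pmf\<close>.\<close>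

definition symbol_pmf :: "real \<Rightarrow> real \<Rightarrow> symbol pmf" where
  "symbol_pmf \<delta> \<epsilon> = embed_pmf (\<lambda>s. case s of
       UpLeft \<Rightarrow> (1 - \<delta>) / 2
     | UpRight \<Rightarrow> (1 - \<delta>) / 2
     | UpBoth \<Rightarrow> \<delta> * (1 - \<epsilon>)
     | Erase \<Rightarrow> \<delta> * \<epsilon>)"

lemma pmf_symbol_pmf:
  assumes "0 \<le> \<delta>" "\<delta> \<le> 1" "0 \<le> \<epsilon>" "\<epsilon> \<le> 1"
  shows "pmf (symbol_pmf \<delta> \<epsilon>) s = (case s of
       UpLeft \<Rightarrow> (1 - \<delta>) / 2
     | UpRight \<Rightarrow> (1 - \<delta>) / 2
     | UpBoth \<Rightarrow> \<delta> * (1 - \<epsilon>)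
     | Erase \<Rightarrow> \<delta> * \<epsilon>)" (is "_ = ?f s")
proof -
  have nonneg: "0 \<le> ?f t" for t
    using assms by (cases t) auto
  have "(\<integral>\<^sup>+t. ennreal (?f t) \<partial>count_space UNIV) = (\<Sum>t\<in>UNIV. ennreal (?f t))"
    by (rule nn_integral_count_space_finite) (simp add: UNIV_symbol)
  also have "\<dots> = ennreal (\<Sum>t\<in>UNIV. ?f t)"
    by (rule sum_ennreal) (rule nonneg)
  also have "(\<Sum>t\<in>UNIV. ?f t) = 1"
    by (simp add: UNIV_symbol field_simps)
  finally show ?thesis
    unfolding symbol_pmf_def by (intro pmf_embed_pmf nonneg) simp
qed

definition verts :: "(int \<times> int) set" where
  "verts = {(x, t). even (x + t)}"

definition symbol_field :: "real \<Rightarrow> real \<Rightarrow> (int \<times> int \<Rightarrow> symbol) measure" where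
  "symbol_field \<delta> \<epsilon> = (\<Pi>\<^sub>M v\<in>verts. measure_pmf (symbol_pmf \<delta> \<epsilon>))"

text \<open>Row \<open>n\<close> is identified with the integers by \<open>(x, - n) \<mapsto> (x + n) / 2\<close>; \<open>vertex n\<close> is the
  inverse of this map.  The lemma records that the upper neighbours of position \<open>i\<close> are the
  positions \<open>i - 1\<close> and \<open>i\<close> of the row above.\<close>

definition vertex :: "nat \<Rightarrow> int \<Rightarrow> int \<times> int" where
  "vertex n i = (2 * i - int n, - int n)"

definition left_nbr :: "int \<times> int \<Rightarrow> int \<times> int" where
  "left_nbr v = (fst v - 1, snd v + 1)"

definition right_nbr :: "int \<times> int \<Rightarrow> int \<times> int" where
  "right_nbr v = (fst v + 1, snd v + 1)"

lemma nbr_vertex: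
  "left_nbr (vertex (Suc n) i) = vertex n (i - 1)"
  "right_nbr (vertex (Suc n) i) = vertex n i"
  by (simp_all add: vertex_def left_nbr_def right_nbr_def)

lemma bij_betw_vertex: "bij_betw (vertex n) UNIV {v \<in> verts. snd v = - int n}"
  unfolding bij_betw_def
proof
  show "inj (vertex n)"
    by (auto simp: inj_def vertex_def)
  show "range (vertex n) = {v \<in> verts. snd v = - int n}"
  proof (intro subset_antisym subsetI)
    fix v assume "v \<in> {v \<in> verts. snd v = - int n}"
    then obtain x where v: "v = (x, - int n)" and "even (x - int n)"
      by (cases v) (auto simp: verts_def)
    then have "even (x + int n)" by simp
    then have "v = vertex n ((x + int n) div 2)"
      by (simp add: v vertex_def)
    then show "v \<in> range (vertex n)" by blast
  qed (auto simp: vertex_def verts_def)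
qed

type_synonym rel01 = "int \<times> int \<Rightarrow> bool"

definition partitions :: "rel01 set" where
  "partitions = {R. equiv UNIV {p. R p}}"

text \<open>The topology on \<^typ>\<open>int \<times> int \<Rightarrow> bool\<close> is the product of discrete topologies.\<close>

definition partition_space :: "rel01 measure" where
  "partition_space = restrict_space borel partitions"

definition class_of :: "rel01 \<Rightarrow> int \<Rightarrow> int set" where
  "class_of R i = {j. R (i, j)}"

text \<open>The colors of row \<open>n\<close> are the classes of row \<open>n - 1\<close> together with, for each position \<open>i\<close>,
  one color \<open>New i\<close> that no other vertex can receive.\<close>

datatype color = Old "int set" | New int

definition color :: "rel01 \<Rightarrow> (int \<Rightarrow> symbol) \<Rightarrow> int \<Rightarrow> color" where
  "color R s i = (case s i of
       UpLeft \<Rightarrow> Old (class_of R (i - 1))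
     | UpRight \<Rightarrow> Old (class_of R i)
     | UpBoth \<Rightarrow> if class_of R (i - 1) = class_of R i then Old (class_of R i) else New i
     | Erase \<Rightarrow> New i)"

definition step :: "rel01 \<Rightarrow> (int \<Rightarrow> symbol) \<Rightarrow> rel01" where
  "step R s = (\<lambda>(i, j). color R s i = color R s j)"

fun state :: "nat \<Rightarrow> rel01 \<Rightarrow> (int \<times> int \<Rightarrow> symbol) \<Rightarrow> rel01" where
  "state 0 R X = R"
| "state (Suc n) R X = step (state n R X) (\<lambda>i. X (vertex (Suc n) i))"

definition law :: "real \<Rightarrow> real \<Rightarrow> rel01 measure \<Rightarrow> nat \<Rightarrow> rel01 measure" where
  "law \<delta> \<epsilon> \<mu> n = distr (\<mu> \<Otimes>\<^sub>M symbol_field \<delta> \<epsilon>) partition_space (\<lambda>(R, X). state n R X)"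

text \<open>The \<open>X v\<close> are i.i.d. in \<open>v\<close>, so \<open>law \<delta> \<epsilon> \<mu> 1\<close> is the image of \<open>\<mu>\<close> under the transition kernel
  of the time-homogeneous Markov process.\<close>

definition invariant :: "real \<Rightarrow> real \<Rightarrow> rel01 measure \<Rightarrow> bool" where
  "invariant \<delta> \<epsilon> \<nu> \<longleftrightarrow> \<nu> \<in> space (prob_algebra partition_space) \<and> law \<delta> \<epsilon> \<nu> 1 = \<nu>"

definition weakly_converges :: "(nat \<Rightarrow> rel01 measure) \<Rightarrow> rel01 measure \<Rightarrow> bool" where
  "weakly_converges \<mu> \<nu> \<longleftrightarrow>
     (\<forall>f :: rel01 \<Rightarrow> real. continuous_on partitions f \<longrightarrow> bounded (f ` partitions) \<longrightarrow>
        (\<lambda>n. \<integral>R. f R \<partial>\<mu> n) \<longlonglongrightarrow> (\<integral>R. f R \<partial>\<nu>))"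

definition ergodic :: "real \<Rightarrow> real \<Rightarrow> bool" where
  "ergodic \<delta> \<epsilon> \<longleftrightarrow>
     (\<exists>\<nu>. invariant \<delta> \<epsilon> \<nu> \<and> (\<forall>\<nu>'. invariant \<delta> \<epsilon> \<nu>' \<longrightarrow> \<nu>' = \<nu>) \<and>
        (\<forall>\<mu> \<in> space (prob_algebra partition_space). weakly_converges (law \<delta> \<epsilon> \<mu>) \<nu>))"

instance bool :: second_countable_topology
proof
  have "(open :: bool set \<Rightarrow> bool) = generate_topology UNIV"
    by (auto simp: fun_eq_iff Topological_Spaces.open_discrete intro: generate_topology.Basis)
  then show "\<exists>B :: bool set set. countable B \<and> open = generate_topology B"
    by (intro exI[of _ UNIV]) auto
qed

lemma class_of_eq_iff:
  assumes "R \<in> partitions"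
  shows "class_of R i = class_of R j \<longleftrightarrow> R (i, j)"
  using assms eq_equiv_class_iff[of UNIV "{p. R p}" i j]
  by (simp add: partitions_def class_of_def Image_def)

lemma step_in_partitions: "step R s \<in> partitions"
  by (auto simp: partitions_def step_def equiv_def refl_on_def sym_def trans_def)

lemma state_in_partitions: "R \<in> partitions \<Longrightarrow> state n R X \<in> partitions"
  by (cases n) (simp_all add: step_in_partitions)

lemma space_partition_space: "space partition_space = partitions"
  by (simp add: partition_space_def space_restrict_space)

lemma measurable_partition_space_coord:
  "(\<lambda>R. R p) \<in> partition_space \<rightarrow>\<^sub>M count_space UNIV"
proof -
  have "(\<lambda>R :: rel01. R p) \<in> borel_measurable borel"
    by (intro borel_measurable_continuous_onI continuous_on_product_coordinates)
  then have "(\<lambda>R. R p) \<in> partition_space \<rightarrow>\<^sub>M borel"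
    unfolding partition_space_def by (rule measurable_restrict_space1)
  then show ?thesis
    by (simp add: measurable_cong_sets[OF refl sets_borel_eq_count_space])
qed

lemma measurable_into_partition_space:
  assumes "\<And>x. x \<in> space M \<Longrightarrow> f x \<in> partitions"
    and "\<And>p. (\<lambda>x. f x p) \<in> M \<rightarrow>\<^sub>M count_space UNIV"
  shows "f \<in> M \<rightarrow>\<^sub>M partition_space"
  unfolding partition_space_def
proof (rule measurable_restrict_space2)
  show "f \<in> M \<rightarrow>\<^sub>M borel"
    by (rule measurable_coordinatewise_then_product)
       (simp add: assms(2) measurable_cong_sets[OF refl sets_borel_eq_count_space])
qed (use assms(1) in auto)

lemma vertex_in_verts: "vertex n i \<in> verts"
  by (simp add: verts_def vertex_def)

text \<open>Hence \<^const>\<open>distr\<close> in the definition of \<^const>\<open>law\<close> is an honest image measure.\<close>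

lemma measurable_state: "(\<lambda>(R, X). state n R X) \<in> partition_space \<Otimes>\<^sub>M symbol_field \<delta> \<epsilon> \<rightarrow>\<^sub>M partition_space"
  (is "_ \<in> ?M \<rightarrow>\<^sub>M _")
proof (induction n)
  case 0
  show ?case by simp
next
  case (Suc n)
  have X [measurable]: "(\<lambda>w. snd w (vertex (Suc n) i)) \<in> ?M \<rightarrow>\<^sub>M count_space UNIV" for i
  proof -
    have "(\<lambda>X. X (vertex (Suc n) i)) \<in> symbol_field \<delta> \<epsilon> \<rightarrow>\<^sub>M measure_pmf (symbol_pmf \<delta> \<epsilon>)"
      unfolding symbol_field_def by (rule measurable_component_singleton) (rule vertex_in_verts)
    then show ?thesis by (simp add: measurable_compose[OF measurable_snd])
  qed
  have R [measurable]: "(\<lambda>w. state n (fst w) (snd w) p) \<in> ?M \<rightarrow>\<^sub>M count_space UNIV" for p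
    using measurable_compose[OF Suc measurable_partition_space_coord]
    by (simp add: case_prod_beta)
  define src where "src R s i = (case s of UpLeft \<Rightarrow> Some (i - 1) | UpRight \<Rightarrow> Some i
     | UpBoth \<Rightarrow> if R (i - 1, i) then Some i else None | Erase \<Rightarrow> None)"
    for R :: rel01 and s and i :: int
  have step: "step R s (i, j) \<longleftrightarrow> i = j \<or> (\<exists>a\<in>{i - 1, i}. \<exists>b\<in>{j - 1, j}.
      src R (s i) i = Some a \<and> src R (s j) j = Some b \<and> R (a, b))"
    if "R \<in> partitions" for R s i j
    using that class_of_eq_iff[OF that, of i i] class_of_eq_iff[OF that, of "i - 1" "i - 1"]
    by (auto simp: step_def color_def src_def class_of_eq_iff split: symbol.splits)
  have src [measurable]: "Measurable.pred ?M
      (\<lambda>w. src (state n (fst w) (snd w)) (snd w (vertex (Suc n) i)) i = Some a)" for i a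
    unfolding src_def
  proof (rule measurable_compose_countable[OF _ X[of i]])
    show "Measurable.pred ?M (\<lambda>w. (case s of UpLeft \<Rightarrow> Some (i - 1) | UpRight \<Rightarrow> Some i
     | UpBoth \<Rightarrow> if state n (fst w) (snd w) (i - 1, i) then Some i else None | Erase \<Rightarrow> None) = Some a)"
      for s
      by (cases s) (simp_all, measurable)
  qed
  show ?case
  proof (rule measurable_into_partition_space)
    fix p :: "int \<times> int"
    obtain i j where p: "p = (i, j)" by (cases p)
    have "Measurable.pred ?M (\<lambda>w. i = j \<or> (\<exists>a\<in>{i - 1, i}. \<exists>b\<in>{j - 1, j}.
        src (state n (fst w) (snd w)) (snd w (vertex (Suc n) i)) i = Some a \<and>
        src (state n (fst w) (snd w)) (snd w (vertex (Suc n) j)) j = Some b \<and>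
        state n (fst w) (snd w) (a, b)))"
      by simp measurable
    then show "(\<lambda>w. (case w of (R, X) \<Rightarrow> state (Suc n) R X) p) \<in> ?M \<rightarrow>\<^sub>M count_space UNIV"
      by (rule measurable_cong[THEN iffD1, rotated])
         (auto simp: p step state_in_partitions space_pair_measure space_partition_space)
  qed (auto simp: step_in_partitions)
qed

end

theory Submission
  imports Defs
begin

text \<open>Call a vertex unerased if none of its ancestors down from the initial row carries \<^const>\<open>Erase\<close>.
  Started from the partition with a single class, the unerased vertices are exactly those with the
  initial color.  Hence, for every initial partition, an unerased vertex never shares its color with an
  erased one, and the partition of the erased vertices is a function of the symbols alone.
  Each further row offers at least one ancestor that is independent of what has been explored so far,
  so a vertex of row \<open>n\<close> is unerased with probability at most \<open>(1 - \<delta> * \<epsilon>) ^ n\<close>.  By Borel--Cantelli, the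
  states at row \<open>0\<close> of the process started at row \<open>- n\<close> converge almost surely, to a limit that does not
  depend on the initial partitions; its law is the invariant distribution.\<close>

subsection \<open>Dependence on the initial partition\<close>

lemma partitions_sym: "R \<in> partitions \<Longrightarrow> R (i, j) \<longleftrightarrow> R (j, i)"
  by (auto simp: partitions_def equiv_def sym_def)

text \<open>The position in the row above from which \<open>i\<close> inherits its color;
  \<open>None\<close> stands for a new color. For \<open>UpBoth\<close> with related parents either
  parent represents the common class, and \<open>i\<close> is the one chosen.\<close>

definition source :: "rel01 \<Rightarrow> (int \<Rightarrow> symbol) \<Rightarrow> int \<Rightarrow> int option" where
  "source R s i = (case s i of
       UpLeft \<Rightarrow> Some (i - 1)
     | UpRight \<Rightarrow> Some i
     | UpBoth \<Rightarrow> if R (i - 1, i) then Some i else None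
     | Erase \<Rightarrow> None)"

text \<open>A new color is shared with no other position, so distinct positions can be related only
  through their sources.\<close>

lemma step_iff:
  assumes "R \<in> partitions"
  shows "step R s (i, j) \<longleftrightarrow>
    i = j \<or> (\<exists>a b. source R s i = Some a \<and> source R s j = Some b \<and> R (a, b))"
  using class_of_eq_iff[OF assms, of i i] class_of_eq_iff[OF assms, of "i - 1" "i - 1"]
  by (auto simp: step_def color_def source_def class_of_eq_iff[OF assms] split: symbol.splits)

text \<open>A step is local: the pair \<open>(i, j)\<close> sees only its parents. This allows a
  step to be exchanged with a coordinatewise limit in the proof of invariance.\<close>

lemma step_cong:
  assumes "R \<in> partitions" "R' \<in> partitions"
    and "\<And>a b. a \<in> {i - 1, i, j - 1, j} \<Longrightarrow> b \<in> {i - 1, i, j - 1, j} \<Longrightarrow> R (a, b) = R' (a, b)"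
  shows "step R s (i, j) = step R' s (i, j)"
  using assms by (auto simp: step_iff source_def split: symbol.splits)

lemma state_cong:
  assumes "\<And>m i. 0 < m \<Longrightarrow> m \<le> n \<Longrightarrow> X (vertex m i) = X' (vertex m i)"
  shows "state n R X = state n R X'"
  using assms by (induction n) auto

text \<open>\<open>state\<close> recurses on the last row; here the first row is split off instead,
  as needed when the starting row moves into the past.\<close>

lemma state_Suc_shift:
  assumes "\<And>m i. 0 < m \<Longrightarrow> m \<le> n \<Longrightarrow> X' (vertex m i) = X (vertex (Suc m) i)"
  shows "state (Suc n) R X = state n (step R (\<lambda>i. X (vertex 1 i))) X'"
  using assms by (induction n) auto

fun unerased :: "nat \<Rightarrow> int \<Rightarrow> (int \<times> int \<Rightarrow> symbol) \<Rightarrow> bool" where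
  "unerased 0 i X \<longleftrightarrow> True"
| "unerased (Suc n) i X \<longleftrightarrow> (case X (vertex (Suc n) i) of
       UpLeft \<Rightarrow> unerased n (i - 1) X
     | UpRight \<Rightarrow> unerased n i X
     | UpBoth \<Rightarrow> unerased n (i - 1) X \<and> unerased n i X
     | Erase \<Rightarrow> False)"

text \<open>Inheritance respects the erased/unerased distinction. The only delicate case is an
  erased \<open>UpBoth\<close> vertex: if exactly one parent is unerased, the parents are unrelated
  by induction and the vertex gets a new color; otherwise both parents are erased.\<close>

lemma unerased_not_related:
  assumes "R \<in> partitions" "unerased n i X" "\<not> unerased n j X"
  shows "\<not> state n R X (i, j)"
  using assms(2,3)
proof (induction n arbitrary: i j)
  case (Suc n)
  let ?R = "state n R X" and ?s = "\<lambda>i. X (vertex (Suc n) i)"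
  have R: "?R \<in> partitions"
    using assms(1) by (rule state_in_partitions)
  have "unerased n a X" if "source ?R ?s i = Some a" for a
    using that Suc.prems(1) by (auto simp: source_def split: symbol.splits if_splits)
  moreover have "\<not> unerased n b X" if "source ?R ?s j = Some b" for b
    using that Suc.prems(2) Suc.IH[of "j - 1" j] Suc.IH[of j "j - 1"] partitions_sym[OF R, of j "j - 1"]
    by (auto simp: source_def split: symbol.splits if_splits)
  ultimately show ?case
    using Suc.IH Suc.prems by (auto simp: step_iff[OF R])
qed simp

text \<open>By induction an erased vertex has the same source under both initial partitions, and
  this source is again erased: mixed parents of an \<open>UpBoth\<close> vertex are unrelated in
  both runs, and the relation between two erased parents agrees.\<close>

lemma state_eq_if_erased:
  assumes R: "R \<in> partitions" "R' \<in> partitions"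
    and "\<not> unerased n i X" "\<not> unerased n j X"
  shows "state n R X (i, j) = state n R' X (i, j)"
  using assms(3,4)
proof (induction n arbitrary: i j)
  case (Suc n)
  let ?R = "state n R X" and ?R' = "state n R' X" and ?s = "\<lambda>i. X (vertex (Suc n) i)"
  have P: "?R \<in> partitions" "?R' \<in> partitions"
    using R by (auto intro: state_in_partitions)
  have not_related: "\<not> ?R (a, b) \<and> \<not> ?R' (a, b)"
    if "unerased n a X \<noteq> unerased n b X" for a b
    using that unerased_not_related[OF R(1), of n] unerased_not_related[OF R(2), of n]
      partitions_sym[OF P(1), of a b] partitions_sym[OF P(2), of a b] by metis
  have src: "source ?R ?s k = source ?R' ?s k \<and> (\<forall>a. source ?R ?s k = Some a \<longrightarrow> \<not> unerased n a X)"
    if "\<not> unerased (Suc n) k X" for k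
    using that Suc.IH[of "k - 1" k] not_related[of "k - 1" k]
    by (auto simp: source_def split: symbol.splits)
  show ?case
    using src[OF Suc.prems(1)] src[OF Suc.prems(2)] Suc.IH
    by (auto simp del: unerased.simps simp: step_iff[OF P(1)] step_iff[OF P(2)])
qed simp

lemma unerased_cong:
  assumes "\<And>m i. 0 < m \<Longrightarrow> m \<le> n \<Longrightarrow> X (vertex m i) = X' (vertex m i)"
  shows "unerased n i X = unerased n i X'"
  using assms by (induction n arbitrary: i) (auto split: symbol.splits)

subsection \<open>Invariance properties of the symbol field\<close>

text \<open>The preimage of a finite cylinder is a rectangle, one side constraining the coordinates
  in \<open>A\<close> and the other the rest. Both sides have product probabilities, and their
  product is the probability of the cylinder.\<close>

lemma distr_merge_PiM:
  fixes p :: "'b measure" and I A :: "'a set" and s t :: "'a \<Rightarrow> 'a"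
  defines "P \<equiv> PiM I (\<lambda>_. p)"
  assumes p: "prob_space p"
    and s: "inj_on s (I \<inter> A)" "s ` (I \<inter> A) \<subseteq> I"
    and t: "inj_on t (I - A)" "t ` (I - A) \<subseteq> I"
  defines "f \<equiv> \<lambda>(x, y). \<lambda>v\<in>I. if v \<in> A then x (s v) else y (t v)"
  shows "f \<in> P \<Otimes>\<^sub>M P \<rightarrow>\<^sub>M P" "distr (P \<Otimes>\<^sub>M P) P f = P"
proof -
  interpret product_prob_space "\<lambda>_. p" I
    using p by (simp add: product_prob_space_def product_prob_space_axioms_def
        product_sigma_finite_def prob_space_imp_sigma_finite)
  interpret Q: prob_space P
    unfolding P_def by (rule prob_space_PiM) (rule p)
  have comp: "(\<lambda>x. x j) \<in> P \<rightarrow>\<^sub>M p" if "j \<in> I" for j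
    unfolding P_def using that by (rule measurable_component_singleton)
  show f: "f \<in> P \<Otimes>\<^sub>M P \<rightarrow>\<^sub>M P"
    unfolding f_def case_prod_beta
  proof (subst (3) P_def, rule measurable_restrict)
    fix v assume v: "v \<in> I"
    show "(\<lambda>w. if v \<in> A then fst w (s v) else snd w (t v)) \<in> P \<Otimes>\<^sub>M P \<rightarrow>\<^sub>M p"
      using v s(2) t(2)
      by (cases "v \<in> A") (auto intro!: measurable_compose[OF measurable_fst comp]
          measurable_compose[OF measurable_snd comp])
  qed
  \<comment> \<open>Injectivity of \<open>r\<close> keeps the coordinates that are read distinct,
    hence independent.\<close>
  have cyl: "{x \<in> space P. \<forall>j\<in>J. x (r j) \<in> F j} \<in> sets P"
      "emeasure P {x \<in> space P. \<forall>j\<in>J. x (r j) \<in> F j} = (\<Prod>j\<in>J. emeasure p (F j))"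
    if J: "finite J" "inj_on r J" "r ` J \<subseteq> I" and F: "\<And>j. j \<in> J \<Longrightarrow> F j \<in> sets p" for r J F
  proof -
    let ?F = "\<lambda>i. F (the_inv_into J r i)"
    have inv: "the_inv_into J r (r j) = j" if "j \<in> J" for j
      using J(2) that by (rule the_inv_into_f_f)
    have eq: "{x \<in> space P. \<forall>j\<in>J. x (r j) \<in> F j} = {x \<in> space P. \<forall>i\<in>r ` J. x i \<in> ?F i}"
      by (auto simp: inv)
    show "{x \<in> space P. \<forall>j\<in>J. x (r j) \<in> F j} \<in> sets P"
      using J F by (intro sets.sets_Collect_finite_All' sets.sets_Collect_finite_All
          measurable_sets_Collect[OF comp]) auto
    have "emeasure P {x \<in> space P. \<forall>i\<in>r ` J. x i \<in> ?F i} = (\<Prod>i\<in>r ` J. emeasure p (?F i))"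
      unfolding P_def using J F by (intro emeasure_PiM_Collect) (auto simp: inv)
    also have "\<dots> = (\<Prod>j\<in>J. emeasure p (F j))"
      using J by (simp add: prod.reindex inv cong: prod.cong)
    finally show "emeasure P {x \<in> space P. \<forall>j\<in>J. x (r j) \<in> F j} = (\<Prod>j\<in>J. emeasure p (F j))"
      by (simp add: eq)
  qed
  show "distr (P \<Otimes>\<^sub>M P) P f = P"
    unfolding P_def
  proof (rule PiM_eq, unfold P_def[symmetric])
    fix J F assume J: "finite J" "J \<subseteq> I" and F: "\<And>j. j \<in> J \<Longrightarrow> F j \<in> sets p"
    let ?E = "prod_emb I (\<lambda>_. p) J (Pi\<^sub>E J F)"
    let ?A = "{x \<in> space P. \<forall>j\<in>J \<inter> A. x (s j) \<in> F j}" and ?B = "{y \<in> space P. \<forall>j\<in>J - A. y (t j) \<in> F j}"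
    have E: "?E = {x \<in> space P. \<forall>j\<in>J. x j \<in> F j}"
      using J by (auto simp: prod_emb_def P_def space_PiM PiE_iff extensional_def)
    have "f -` ?E \<inter> space (P \<Otimes>\<^sub>M P) = ?A \<times> ?B"
    proof -
      have "f w \<in> space P" if "w \<in> space (P \<Otimes>\<^sub>M P)" for w
        using f that by (rule measurable_space)
      then show ?thesis
        using J unfolding E by (fastforce simp: space_pair_measure f_def)
    qed
    moreover have JI: "s ` (J \<inter> A) \<subseteq> I" "t ` (J - A) \<subseteq> I"
      using J(2) by (auto intro: subsetD[OF s(2)] subsetD[OF t(2)])
    moreover have "?A \<in> sets P" "?B \<in> sets P"
      "emeasure P ?A = (\<Prod>j\<in>J \<inter> A. emeasure p (F j))" "emeasure P ?B = (\<Prod>j\<in>J - A. emeasure p (F j))"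
      using J F JI by (intro cyl inj_on_subset[OF s(1)] inj_on_subset[OF t(1)]; auto)+
    moreover have "?E \<in> sets P"
      unfolding P_def using J F by (intro sets_PiM_I) auto
    ultimately have "emeasure (distr (P \<Otimes>\<^sub>M P) P f) ?E
        = (\<Prod>j\<in>J \<inter> A. emeasure p (F j)) * (\<Prod>j\<in>J - A. emeasure p (F j))"
      using f by (simp add: emeasure_distr Q.emeasure_pair_measure_Times)
    also have "\<dots> = (\<Prod>j\<in>J. emeasure p (F j))"
      using prod.Int_Diff[OF J(1), of "\<lambda>j. emeasure p (F j)" A] by simp
    finally show "emeasure (distr (P \<Otimes>\<^sub>M P) P f) ?E = (\<Prod>j\<in>J. emeasure p (F j))" .
  qed simp
qed

text \<open>A diagonal translation preserves the parity condition for every \<open>k\<close>, and it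
  matches \<open>vertex\<close>: position \<open>i\<close> of row \<open>n\<close> moves by
  \<open>(n, n)\<close> to \<open>(2 * i, 0)\<close>, whatever \<open>n\<close> is.\<close>

definition diagonal_shift :: "int \<Rightarrow> (int \<times> int \<Rightarrow> symbol) \<Rightarrow> int \<times> int \<Rightarrow> symbol" where
  "diagonal_shift k X = (\<lambda>v\<in>verts. X (fst v + k, snd v + k))"

lemma add_diagonal_in_verts: "v \<in> verts \<Longrightarrow> (fst v + k, snd v + k) \<in> verts"
  by (auto simp: verts_def)

lemma inj_add_diagonal: "inj_on (\<lambda>v :: int \<times> int. (fst v + k, snd v + k)) S"
  by (auto simp: inj_on_def prod_eq_iff)

lemma prob_space_symbol_field: "prob_space (symbol_field \<delta> \<epsilon>)"
  unfolding symbol_field_def by (intro prob_space_PiM prob_space_measure_pmf)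

lemma measurable_symbol_at [measurable]:
  assumes "v \<in> verts"
  shows "(\<lambda>X. X v) \<in> symbol_field \<delta> \<epsilon> \<rightarrow>\<^sub>M count_space UNIV"
proof -
  have "(\<lambda>X. X v) \<in> symbol_field \<delta> \<epsilon> \<rightarrow>\<^sub>M measure_pmf (symbol_pmf \<delta> \<epsilon>)"
    unfolding symbol_field_def using assms by (rule measurable_component_singleton)
  then show ?thesis by simp
qed

lemma measure_symbol_at:
  assumes "v \<in> verts"
  shows "measure (symbol_field \<delta> \<epsilon>) {X \<in> space (symbol_field \<delta> \<epsilon>). X v = s} = pmf (symbol_pmf \<delta> \<epsilon>) s"
proof -
  let ?F = "symbol_field \<delta> \<epsilon>" and ?p = "measure_pmf (symbol_pmf \<delta> \<epsilon>)"
  have "measure ?p {s} = measure (distr ?F ?p (\<lambda>X. X v)) {s}"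
    using assms distr_PiM_component[of verts "\<lambda>_. ?p" v]
    by (simp add: symbol_field_def prob_space_measure_pmf)
  also have "\<dots> = measure ?F {X \<in> space ?F. X v = s}"
    using measurable_symbol_at[OF assms]
    by (subst measure_distr) (auto intro!: arg_cong2[where f = measure])
  finally show ?thesis by (simp add: pmf.rep_eq)
qed

lemma measurable_shift [measurable]: "diagonal_shift k \<in> symbol_field \<delta> \<epsilon> \<rightarrow>\<^sub>M symbol_field \<delta> \<epsilon>"
  unfolding diagonal_shift_def symbol_field_def
  by (intro measurable_restrict measurable_component_singleton add_diagonal_in_verts)

lemma distr_shift: "distr (symbol_field \<delta> \<epsilon>) (symbol_field \<delta> \<epsilon>) (diagonal_shift k) = symbol_field \<delta> \<epsilon>"
  using distr_PiM_reindex[OF _ inj_add_diagonal[of k verts], of verts "\<lambda>_. measure_pmf (symbol_pmf \<delta> \<epsilon>)"]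
  by (simp add: diagonal_shift_def[abs_def] symbol_field_def prob_space_measure_pmf add_diagonal_in_verts)

text \<open>Splicing two independent copies of the field turns the Markov property and the independence of
  row \<open>n + 1\<close> from the earlier rows into invariance of the law of the field.\<close>

definition merge_fields :: "(int \<times> int) set \<Rightarrow> int \<Rightarrow> int \<Rightarrow> (int \<times> int \<Rightarrow> symbol) \<times> (int \<times> int \<Rightarrow> symbol)
    \<Rightarrow> int \<times> int \<Rightarrow> symbol" where
  "merge_fields A k l = (\<lambda>(X, Y). \<lambda>v\<in>verts. if v \<in> A then X (fst v + k, snd v + k) else Y (fst v + l, snd v + l))"

lemma merge_fields_apply:
  "v \<in> verts \<Longrightarrow> merge_fields A k l (X, Y) v = (if v \<in> A then X (fst v + k, snd v + k) else Y (fst v + l, snd v + l))"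
  by (simp add: merge_fields_def)

lemma
  shows measurable_merge_fields [measurable]:
      "merge_fields A k l \<in> symbol_field \<delta> \<epsilon> \<Otimes>\<^sub>M symbol_field \<delta> \<epsilon> \<rightarrow>\<^sub>M symbol_field \<delta> \<epsilon>"
    and distr_merge_fields:
      "distr (symbol_field \<delta> \<epsilon> \<Otimes>\<^sub>M symbol_field \<delta> \<epsilon>) (symbol_field \<delta> \<epsilon>) (merge_fields A k l) = symbol_field \<delta> \<epsilon>"
proof -
  have verts: "(\<lambda>v. (fst v + k, snd v + k)) ` S \<subseteq> verts" if "S \<subseteq> verts" for k S
    using that add_diagonal_in_verts by blast
  note * = distr_merge_PiM[OF prob_space_measure_pmf inj_add_diagonal verts[OF Int_lower1]
      inj_add_diagonal verts[OF Diff_subset], where A = A]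
  show "merge_fields A k l \<in> symbol_field \<delta> \<epsilon> \<Otimes>\<^sub>M symbol_field \<delta> \<epsilon> \<rightarrow>\<^sub>M symbol_field \<delta> \<epsilon>"
    "distr (symbol_field \<delta> \<epsilon> \<Otimes>\<^sub>M symbol_field \<delta> \<epsilon>) (symbol_field \<delta> \<epsilon>) (merge_fields A k l) = symbol_field \<delta> \<epsilon>"
    unfolding symbol_field_def merge_fields_def by (rule *)+
qed

section \<open>Geometric decay of the probability of being unerased\<close>

lemma measurable_unerased [measurable]: "Measurable.pred (symbol_field \<delta> \<epsilon>) (unerased n i)"
proof (induction n arbitrary: i)
  case 0
  have "unerased 0 i = (\<lambda>_. True)" by auto
  then show ?case by simp
next
  case (Suc n)
  note Suc [measurable] and vertex_in_verts [measurable]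
  have "Measurable.pred (symbol_field \<delta> \<epsilon>) (\<lambda>X.
      X (vertex (Suc n) i) = UpLeft \<and> unerased n (i - 1) X \<or>
      X (vertex (Suc n) i) = UpRight \<and> unerased n i X \<or>
      X (vertex (Suc n) i) = UpBoth \<and> unerased n (i - 1) X \<and> unerased n i X)"
    by measurable
  then show ?case
    by (rule measurable_cong[THEN iffD1, rotated]) (auto split: symbol.splits)
qed

text \<open>The symbol at the new vertex is independent of the rows above. Following a single parent
  even for \<open>UpBoth\<close> gives the factor \<open>(1 - \<delta>) / 2 + (1 - \<delta>) / 2 +
  \<delta> * (1 - \<epsilon>)\<close>, which is \<open>1 - \<delta> * \<epsilon>\<close>.\<close>

lemma measure_unerased:
  assumes "0 \<le> \<delta>" "\<delta> \<le> 1" "0 \<le> \<epsilon>" "\<epsilon> \<le> 1"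
  shows "measure (symbol_field \<delta> \<epsilon>) {X \<in> space (symbol_field \<delta> \<epsilon>). unerased n i X} \<le> (1 - \<delta> * \<epsilon>) ^ n"
proof (induction n arbitrary: i)
  case 0
  show ?case by (simp add: prob_space.prob_le_1[OF prob_space_symbol_field])
next
  case (Suc n)
  let ?F = "symbol_field \<delta> \<epsilon>" and ?w = "vertex (Suc n) i"
  interpret prob_space ?F
    by (rule prob_space_symbol_field)
  interpret FF: pair_prob_space ?F ?F ..
  note vertex_in_verts [measurable]
  define U where "U j = {X \<in> space ?F. unerased n j X}" for j
  define S where "S s = {X \<in> space ?F. X ?w = s}" for s
  have U [measurable]: "U j \<in> sets ?F" for j
    unfolding U_def by measurable
  have S [measurable]: "S s \<in> sets ?F" for s
    unfolding S_def by measurable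
  have US: "FF.prob (U j \<times> S s) \<le> (1 - \<delta> * \<epsilon>) ^ n * pmf (symbol_pmf \<delta> \<epsilon>) s" for j s
  proof -
    have "FF.prob (U j \<times> S s) = prob (U j) * prob (S s)"
      by (simp add: measure_def emeasure_pair_measure_Times enn2real_mult)
    also have "prob (S s) = pmf (symbol_pmf \<delta> \<epsilon>) s"
      unfolding S_def by (rule measure_symbol_at) (rule vertex_in_verts)
    finally show ?thesis
      using Suc.IH[of j] by (simp add: U_def mult_right_mono)
  qed
  \<comment> \<open>Only the symbol at \<open>?w\<close> is resampled from the second copy;
    \<open>unerased n\<close> reads rows \<open>1\<close> to \<open>n\<close> and does not
    notice.\<close>
  let ?G = "merge_fields (- {?w}) 0 0"
  have X: "unerased n j (?G (X, Y)) = unerased n j X" for j X Y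
    by (rule unerased_cong) (simp add: merge_fields_apply vertex_in_verts, simp add: vertex_def)
  have Y: "?G (X, Y) ?w = Y ?w" for X Y
    by (simp add: merge_fields_apply vertex_in_verts)
  have "prob {X \<in> space ?F. unerased (Suc n) i X}
      = measure (distr (?F \<Otimes>\<^sub>M ?F) ?F ?G) {X \<in> space ?F. unerased (Suc n) i X}"
    by (simp add: distr_merge_fields)
  also have "\<dots> = FF.prob {w \<in> space (?F \<Otimes>\<^sub>M ?F). unerased (Suc n) i (?G w)}"
    using measurable_space[OF measurable_merge_fields[of "- {?w}" 0 0 \<delta> \<epsilon>]]
    by (subst measure_distr) (auto simp del: unerased.simps intro!: arg_cong2[where f = measure])
  \<comment> \<open>For \<open>UpBoth\<close> the left parent is dropped, since the two parents need
    not be independent.\<close>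
  also have "\<dots> \<le> FF.prob (U (i - 1) \<times> S UpLeft \<union> U i \<times> S UpRight \<union> U i \<times> S UpBoth)"
  proof (intro FF.finite_measure_mono subsetI)
    fix w assume w: "w \<in> {w \<in> space (?F \<Otimes>\<^sub>M ?F). unerased (Suc n) i (?G w)}"
    obtain X' Y' where "w = (X', Y')" by (cases w)
    then show "w \<in> U (i - 1) \<times> S UpLeft \<union> U i \<times> S UpRight \<union> U i \<times> S UpBoth"
      using w by (cases "Y' ?w") (simp_all add: X Y U_def S_def space_pair_measure)
  qed measurable
  also have "\<dots> \<le> FF.prob (U (i - 1) \<times> S UpLeft) + FF.prob (U i \<times> S UpRight) + FF.prob (U i \<times> S UpBoth)"
    by (intro order_trans[OF measure_Un_le] add_right_mono
        measure_Un_le) measurable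
  also have "\<dots> \<le> (1 - \<delta> * \<epsilon>) ^ n * ((1 - \<delta>) / 2 + (1 - \<delta>) / 2 + \<delta> * (1 - \<epsilon>))"
    using US[of "i - 1" UpLeft] US[of i UpRight] US[of i UpBoth] pmf_symbol_pmf[OF assms]
    by (simp add: distrib_left)
  also have "\<dots> = (1 - \<delta> * \<epsilon>) ^ Suc n"
    by (simp add: field_simps)
  finally show ?case .
qed

subsection \<open>Coupling from the past\<close>

abbreviation discrete_partition :: rel01 where
  "discrete_partition \<equiv> (\<lambda>(i, j). i = j)"

lemma discrete_partition_in_partitions: "discrete_partition \<in> partitions"
  by (auto simp: partitions_def equiv_def refl_on_def sym_def trans_def)

lemma shift_vertex: "diagonal_shift k X (vertex m i) = X (2 * i - int m + k, k - int m)"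
  by (simp add: diagonal_shift_def vertex_in_verts) (simp add: vertex_def)

text \<open>Evolution from row \<open>- n\<close> to row \<open>0\<close>, with \<open>n\<close> tending to infinity (coupling from the past).  The lower
  limit of partitions is a partition for every \<open>X\<close>, convergent or not.\<close>

definition stationary_state :: "(int \<times> int \<Rightarrow> symbol) \<Rightarrow> rel01" where
  "stationary_state X p \<longleftrightarrow> (\<forall>\<^sub>F n in sequentially. state n discrete_partition (diagonal_shift (int n) X) p)"

text \<open>Eventual truth passes through finite conjunctions, hence through transitivity. Having a
  partition for every \<open>X\<close>, not just almost every one, makes
  \<open>stationary_state\<close> a map into \<open>partition_space\<close>.\<close>

lemma stationary_state_in_partitions: "stationary_state X \<in> partitions"
proof -
  let ?R = "\<lambda>n. state n discrete_partition (diagonal_shift (int n) X)"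
  have R: "?R n \<in> partitions" for n
    by (rule state_in_partitions) (rule discrete_partition_in_partitions)
  have refl: "stationary_state X (i, i)" for i
  proof -
    have "?R n (i, i)" for n
      using R[of n] by (simp add: partitions_def equiv_def refl_on_def)
    then show ?thesis by (simp add: stationary_state_def)
  qed
  have sym: "stationary_state X (j, i)" if "stationary_state X (i, j)" for i j
    using that partitions_sym[OF R, of _ i j] by (simp add: stationary_state_def)
  have trans: "stationary_state X (i, k)" if "stationary_state X (i, j)" "stationary_state X (j, k)" for i j k
    using that unfolding stationary_state_def
  proof (rule eventually_elim2)
    show "?R n (i, k)" if "?R n (i, j)" "?R n (j, k)" for n
      using R[of n] that by (auto simp: partitions_def equiv_def trans_def)
  qed
  let ?r = "{p. stationary_state X p}"
  have "refl ?r"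
    by (rule refl_onI) (simp add: refl)
  moreover have "Relation.sym ?r"
    by (rule symI) (simp add: sym)
  moreover have "Relation.trans ?r"
    by (rule transI) (simp, rule trans)
  ultimately show ?thesis
    by (simp add: partitions_def equiv_def)
qed

section \<open>Measurability and almost sure existence of the limit\<close>

lemma measurable_state_const:
  assumes "R \<in> partitions"
  shows "state n R \<in> symbol_field \<delta> \<epsilon> \<rightarrow>\<^sub>M partition_space"
  using measurable_compose[OF measurable_Pair1' measurable_state, of R n \<delta> \<epsilon>] assms
  by (simp add: space_partition_space)

lemma measurable_stationary_state [measurable]:
  "stationary_state \<in> symbol_field \<delta> \<epsilon> \<rightarrow>\<^sub>M partition_space"
proof (rule measurable_into_partition_space)
  fix p
  have [measurable]: "Measurable.pred (symbol_field \<delta> \<epsilon>)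
      (\<lambda>X. state n discrete_partition (diagonal_shift (int n) X) p)" for n
    by (rule measurable_compose[OF measurable_shift
          measurable_compose[OF measurable_state_const measurable_partition_space_coord]])
       (rule discrete_partition_in_partitions)
  show "Measurable.pred (symbol_field \<delta> \<epsilon>) (\<lambda>X. stationary_state X p)"
    unfolding stationary_state_def eventually_sequentially by measurable
qed (rule stationary_state_in_partitions)

text \<open>Starting one row earlier amounts to replacing the initial partition on the later
  starting row.\<close>

lemma state_Suc_shift_field:
  "state (Suc n) R (diagonal_shift (int (Suc n)) X)
    = state n (step R (\<lambda>i. diagonal_shift (int (Suc n)) X (vertex 1 i))) (diagonal_shift (int n) X)"
  by (rule state_Suc_shift) (simp add: shift_vertex algebra_simps)

text \<open>Once both positions of \<open>p\<close> are erased, the value at \<open>p\<close>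
  ignores the initial partition. Moving the start back changes nothing but that partition, so the
  sequence of values becomes constant.\<close>

lemma eventually_state_eq_stationary_state:
  assumes erased: "\<And>i. \<forall>\<^sub>F n in sequentially. \<not> unerased n i (diagonal_shift (int n) X)"
    and R: "R \<in> partitions"
  shows "\<forall>\<^sub>F n in sequentially. state n R (diagonal_shift (int n) X) p = stationary_state X p"
proof -
  obtain i j where p: "p = (i, j)" by (cases p)
  let ?S = "\<lambda>n. state n discrete_partition (diagonal_shift (int n) X) p"
  obtain N where N: "\<not> unerased n i (diagonal_shift (int n) X) \<and> \<not> unerased n j (diagonal_shift (int n) X)" if "n \<ge> N" for n
    using eventually_conj[OF erased[of i] erased[of j]] by (auto simp: eventually_sequentially)
  have eq: "state n R' (diagonal_shift (int n) X) p = ?S n" if "n \<ge> N" "R' \<in> partitions" for n R'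
    unfolding p using N[OF that(1)] that(2) discrete_partition_in_partitions
    by (intro state_eq_if_erased) auto
  have "?S n = ?S N" if "n \<ge> N" for n
    using that
  proof (induction n rule: dec_induct)
    case (step n)
    have "?S (Suc n) = ?S n"
      unfolding state_Suc_shift_field by (rule eq) (simp_all add: step.hyps step_in_partitions)
    with step.IH show ?case by simp
  qed simp
  then obtain b where b: "?S n = b" if "n \<ge> N" for n
    by blast
  then have "\<forall>\<^sub>F n in sequentially. ?S n = b" "\<forall>\<^sub>F n in sequentially. state n R (diagonal_shift (int n) X) p = b"
    using eq[OF _ R] by (auto intro!: eventually_sequentiallyI[of N])
  \<comment> \<open>As \<open>sequentially\<close> is a proper filter, the constant \<open>b\<close>
    holds eventually iff it holds.\<close>
  moreover from this(1) have "stationary_state X p = (\<forall>\<^sub>F n :: nat in sequentially. b)"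
    unfolding stationary_state_def by (rule eventually_cong) simp
  ultimately show ?thesis by simp
qed

text \<open>The shift preserves the law of the field, so the geometric bound applies to every
  \<open>n\<close>; it is summable because \<open>\<delta> * \<epsilon>\<close> is positive.\<close>

lemma AE_eventually_erased:
  assumes "0 < \<delta>" "\<delta> \<le> 1" "0 < \<epsilon>" "\<epsilon> \<le> 1"
  shows "AE X in symbol_field \<delta> \<epsilon>. \<forall>i. \<forall>\<^sub>F n in sequentially. \<not> unerased n i (diagonal_shift (int n) X)"
  unfolding AE_all_countable
proof
  fix i
  let ?F = "symbol_field \<delta> \<epsilon>"
  interpret prob_space ?F by (rule prob_space_symbol_field)
  define A where "A n = {X \<in> space ?F. unerased n i (diagonal_shift (int n) X)}" for n
  have "prob (A n) \<le> (1 - \<delta> * \<epsilon>) ^ n" for n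
  proof -
    have "prob (A n) = measure (distr ?F ?F (diagonal_shift (int n))) {X \<in> space ?F. unerased n i X}"
      using measurable_space[OF measurable_shift[of "int n" \<delta> \<epsilon>]]
      by (subst measure_distr) (auto simp: A_def intro!: arg_cong2[where f = measure])
    also have "\<dots> \<le> (1 - \<delta> * \<epsilon>) ^ n"
      using measure_unerased[of \<delta> \<epsilon> n i] assms by (simp add: distr_shift)
    finally show ?thesis .
  qed
  moreover have "\<delta> * \<epsilon> \<le> 1" "0 < \<delta> * \<epsilon>"
    using assms by (auto intro: mult_le_one)
  ultimately have "summable (\<lambda>n. prob (A n))"
    by (intro summable_comparison_test[OF _ summable_geometric[of "1 - \<delta> * \<epsilon>"]]) auto
  then have "AE X in ?F. \<forall>\<^sub>F n in sequentially. X \<in> space ?F - A n"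
    by (intro borel_cantelli_AE1) (auto simp: A_def emeasure_eq_measure)
  then show "AE X in ?F. \<forall>\<^sub>F n in sequentially. \<not> unerased n i (diagonal_shift (int n) X)"
    by eventually_elim (auto simp: A_def elim: eventually_mono)
qed

section \<open>Laws of the process and weak convergence\<close>

lemma distr_pair_snd:
  assumes "prob_space M" "prob_space N"
  shows "distr (M \<Otimes>\<^sub>M N) N snd = N"
proof (rule measure_eqI)
  interpret M: prob_space M by fact
  interpret N: prob_space N by fact
  fix A assume "A \<in> sets (distr (M \<Otimes>\<^sub>M N) N snd)"
  then have A: "A \<in> sets N" by simp
  then have "snd -` A \<inter> space (M \<Otimes>\<^sub>M N) = space M \<times> A"
    using sets.sets_into_space by (auto simp: space_pair_measure)
  then show "emeasure (distr (M \<Otimes>\<^sub>M N) N snd) A = emeasure N A"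
    using A by (simp add: emeasure_distr N.emeasure_pair_measure_Times M.emeasure_space_1)
qed simp

lemma prob_algebra_partition_spaceD:
  assumes "\<mu> \<in> space (prob_algebra partition_space)"
  shows "prob_space \<mu>" "sets \<mu> = sets partition_space"
  using assms by (auto simp: space_prob_algebra)

lemma measurable_state_prob_algebra:
  assumes "\<mu> \<in> space (prob_algebra partition_space)"
  shows "(\<lambda>(R, X). state n R X) \<in> \<mu> \<Otimes>\<^sub>M symbol_field \<delta> \<epsilon> \<rightarrow>\<^sub>M partition_space"
  using measurable_state[of n \<delta> \<epsilon>] prob_algebra_partition_spaceD(2)[OF assms]
  by (simp cong: measurable_cong_sets sets_pair_measure_cong)

lemma law_in_prob_algebra:
  assumes "\<mu> \<in> space (prob_algebra partition_space)"
  shows "law \<delta> \<epsilon> \<mu> n \<in> space (prob_algebra partition_space)"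
proof -
  interpret \<mu>: prob_space \<mu> using assms by (rule prob_algebra_partition_spaceD)
  interpret F: prob_space "symbol_field \<delta> \<epsilon>" by (rule prob_space_symbol_field)
  interpret pair_prob_space \<mu> "symbol_field \<delta> \<epsilon>" ..
  show ?thesis
    unfolding law_def space_prob_algebra
    by (auto intro!: prob_space_distr measurable_state_prob_algebra assms)
qed

text \<open>Realizes the laws for all \<open>n\<close> on one probability space, as row
  \<open>0\<close> of runs started ever earlier in the same field; there the states converge almost
  surely.\<close>

lemma law_eq_distr_shift:
  assumes "\<mu> \<in> space (prob_algebra partition_space)"
  shows "law \<delta> \<epsilon> \<mu> n
    = distr (\<mu> \<Otimes>\<^sub>M symbol_field \<delta> \<epsilon>) partition_space (\<lambda>(R, X). state n R (diagonal_shift (int n) X))"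
proof -
  let ?F = "symbol_field \<delta> \<epsilon>"
  interpret F: prob_space ?F by (rule prob_space_symbol_field)
  have "distr \<mu> \<mu> (\<lambda>R. R) \<Otimes>\<^sub>M distr ?F ?F (diagonal_shift (int n))
      = distr (\<mu> \<Otimes>\<^sub>M ?F) (\<mu> \<Otimes>\<^sub>M ?F) (\<lambda>(R, X). (R, diagonal_shift (int n) X))"
    by (rule pair_measure_distr) (simp_all add: distr_shift F.sigma_finite_measure_axioms)
  then have "law \<delta> \<epsilon> \<mu> n = distr (distr (\<mu> \<Otimes>\<^sub>M ?F) (\<mu> \<Otimes>\<^sub>M ?F) (\<lambda>(R, X). (R, diagonal_shift (int n) X)))
      partition_space (\<lambda>(R, X). state n R X)"
    by (simp add: law_def distr_shift)
  also have "\<dots> = distr (\<mu> \<Otimes>\<^sub>M ?F) partition_space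
      ((\<lambda>(R, X). state n R X) \<circ> (\<lambda>(R, X). (R, diagonal_shift (int n) X)))"
    by (rule distr_distr) (use measurable_state_prob_algebra[OF assms] in measurable)
  finally show ?thesis by (simp add: comp_def case_prod_unfold)
qed

lemma tendsto_fun_discrete:
  fixes f :: "'c \<Rightarrow> 'a \<Rightarrow> 'b::discrete_topology"
  assumes "\<And>p. \<forall>\<^sub>F n in F. f n p = l p"
  shows "(f \<longlongrightarrow> l) F"
proof -
  have "limitin (product_topology (\<lambda>_. euclidean) UNIV) f l F"
    unfolding limitin_componentwise by (auto intro: tendsto_eventually assms)
  then show ?thesis
    by (simp add: euclidean_product_topology)
qed

text \<open>Almost sure convergence on the common space yields convergence of integrals of bounded
  continuous functions by dominated convergence.\<close>

lemma weakly_converges_law: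
  assumes param: "0 < \<delta>" "\<delta> \<le> 1" "0 < \<epsilon>" "\<epsilon> \<le> 1"
    and \<mu>: "\<mu> \<in> space (prob_algebra partition_space)"
  shows "weakly_converges (law \<delta> \<epsilon> \<mu>) (distr (symbol_field \<delta> \<epsilon>) partition_space stationary_state)"
  unfolding weakly_converges_def
proof (intro allI impI)
  fix f :: "rel01 \<Rightarrow> real"
  assume f: "continuous_on partitions f" "bounded (f ` partitions)"
  let ?F = "symbol_field \<delta> \<epsilon>"
  interpret \<mu>: prob_space \<mu> using \<mu> by (rule prob_algebra_partition_spaceD)
  interpret F: prob_space ?F by (rule prob_space_symbol_field)
  interpret P: pair_prob_space \<mu> ?F ..
  have space_\<mu>: "space \<mu> = partitions"
    using prob_algebra_partition_spaceD(2)[OF \<mu>, THEN sets_eq_imp_space_eq]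
    by (simp add: space_partition_space)
  obtain B where B: "norm (f R) \<le> B" if "R \<in> partitions" for R
    using f(2) by (auto simp: bounded_iff)
  have f_meas: "f \<in> borel_measurable partition_space"
    unfolding partition_space_def by (rule borel_measurable_continuous_on_restrict) (rule f)
  have state: "(\<lambda>(R, X). state n R (diagonal_shift (int n) X)) \<in> \<mu> \<Otimes>\<^sub>M ?F \<rightarrow>\<^sub>M partition_space" for n
  proof -
    have "(\<lambda>(R, X). (R, diagonal_shift (int n) X)) \<in> \<mu> \<Otimes>\<^sub>M ?F \<rightarrow>\<^sub>M \<mu> \<Otimes>\<^sub>M ?F"
      by measurable
    from measurable_compose[OF this measurable_state_prob_algebra[OF \<mu>]] show ?thesis
      by (simp add: case_prod_beta)
  qed
  have snd: "distr (\<mu> \<Otimes>\<^sub>M ?F) ?F snd = ?F"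
    by (rule distr_pair_snd) unfold_locales
  have "AE X in distr (\<mu> \<Otimes>\<^sub>M ?F) ?F snd. \<forall>i. \<forall>\<^sub>F n in sequentially. \<not> unerased n i (diagonal_shift (int n) X)"
    unfolding snd by (rule AE_eventually_erased[OF param])
  then have erased: "AE w in \<mu> \<Otimes>\<^sub>M ?F. \<forall>i. \<forall>\<^sub>F n in sequentially. \<not> unerased n i (diagonal_shift (int n) (snd w))"
    by (rule AE_distrD[OF measurable_snd])
  have "(\<lambda>n. \<integral>w. f (case w of (R, X) \<Rightarrow> state n R (diagonal_shift (int n) X)) \<partial>(\<mu> \<Otimes>\<^sub>M ?F))
      \<longlonglongrightarrow> (\<integral>w. f (stationary_state (snd w)) \<partial>(\<mu> \<Otimes>\<^sub>M ?F))"
  proof (rule integral_dominated_convergence)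
    show "(\<lambda>w. f (stationary_state (snd w))) \<in> borel_measurable (\<mu> \<Otimes>\<^sub>M ?F)"
      by (intro measurable_compose[OF _ f_meas] measurable_compose[OF measurable_snd measurable_stationary_state])
    show "(\<lambda>w. f (case w of (R, X) \<Rightarrow> state n R (diagonal_shift (int n) X))) \<in> borel_measurable (\<mu> \<Otimes>\<^sub>M ?F)" for n
      by (rule measurable_compose[OF state f_meas])
    show "AE w in \<mu> \<Otimes>\<^sub>M ?F. norm (f (case w of (R, X) \<Rightarrow> state n R (diagonal_shift (int n) X))) \<le> B" for n
      by (intro AE_I2 B) (auto simp: space_pair_measure space_\<mu> intro: state_in_partitions)
    show "AE w in \<mu> \<Otimes>\<^sub>M ?F. (\<lambda>n. f (case w of (R, X) \<Rightarrow> state n R (diagonal_shift (int n) X)))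
        \<longlonglongrightarrow> f (stationary_state (snd w))"
      using erased AE_space
    proof eventually_elim
      case (elim w)
      obtain R X where w: "w = (R, X)" by (cases w)
      have R: "R \<in> partitions"
        using elim(2) by (simp add: w space_pair_measure space_\<mu>)
      have "(\<lambda>n. state n R (diagonal_shift (int n) X)) \<longlonglongrightarrow> stationary_state X"
        using elim(1) R by (intro tendsto_fun_discrete eventually_state_eq_stationary_state) (auto simp: w)
      then show ?case
        using R f(1) by (auto simp: w stationary_state_in_partitions state_in_partitions
            intro!: continuous_on_tendsto_compose[OF f(1)])
    qed
  \<comment> \<open>What remains is integrability of the constant bound \<open>B\<close> under a
    probability measure.\<close>
  qed simp
  moreover have "(\<integral>R. f R \<partial>law \<delta> \<epsilon> \<mu> n)
      = (\<integral>w. f (case w of (R, X) \<Rightarrow> state n R (diagonal_shift (int n) X)) \<partial>(\<mu> \<Otimes>\<^sub>M ?F))" for n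
    unfolding law_eq_distr_shift[OF \<mu>] by (rule integral_distr[OF state f_meas])
  moreover have "(\<integral>R. f R \<partial>distr ?F partition_space stationary_state)
      = (\<integral>w. f (stationary_state (snd w)) \<partial>(\<mu> \<Otimes>\<^sub>M ?F))"
  proof -
    have "(\<integral>R. f R \<partial>distr ?F partition_space stationary_state) = (\<integral>X. f (stationary_state X) \<partial>?F)"
      by (rule integral_distr[OF measurable_stationary_state f_meas])
    also have "\<dots> = (\<integral>X. f (stationary_state X) \<partial>distr (\<mu> \<Otimes>\<^sub>M ?F) ?F snd)"
      by (simp add: snd)
    also have "\<dots> = (\<integral>w. f (stationary_state (snd w)) \<partial>(\<mu> \<Otimes>\<^sub>M ?F))"
      by (rule integral_distr) (auto intro: measurable_compose[OF measurable_stationary_state f_meas])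
    finally show ?thesis .
  qed
  ultimately show "(\<lambda>n. \<integral>R. f R \<partial>law \<delta> \<epsilon> \<mu> n)
      \<longlonglongrightarrow> (\<integral>R. f R \<partial>distr ?F partition_space stationary_state)"
    by simp
qed

subsection \<open>Invariance and uniqueness\<close>

text \<open>The Markov property: row \<open>n + 1\<close> is independent of the rows above and of
  the initial partition, so it may be read from a fresh copy of the field.\<close>

lemma law_Suc:
  assumes \<mu>: "\<mu> \<in> space (prob_algebra partition_space)"
  shows "law \<delta> \<epsilon> \<mu> (Suc n) = law \<delta> \<epsilon> (law \<delta> \<epsilon> \<mu> n) 1"
proof (rule measure_eqI)
  show "sets (law \<delta> \<epsilon> \<mu> (Suc n)) = sets (law \<delta> \<epsilon> (law \<delta> \<epsilon> \<mu> n) 1)"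
    by (simp add: law_def)
  fix B assume "B \<in> sets (law \<delta> \<epsilon> \<mu> (Suc n))"
  then have B [measurable]: "B \<in> sets partition_space"
    by (simp add: law_def)
  let ?F = "symbol_field \<delta> \<epsilon>" and ?L = "law \<delta> \<epsilon> \<mu> n"
  let ?b = "indicator B :: rel01 \<Rightarrow> ennreal"
  \<comment> \<open>Rows up to \<open>n\<close> come from the first copy; row \<open>n + 1\<close>
    is row \<open>1\<close> of the second.\<close>
  let ?G = "merge_fields {v. - int n \<le> snd v} 0 (int n)"
  interpret F: prob_space ?F by (rule prob_space_symbol_field)
  note meas = measurable_state_prob_algebra
  have L: "?L \<in> space (prob_algebra partition_space)"
    by (rule law_in_prob_algebra) (rule \<mu>)
  have space_\<mu>: "space \<mu> = partitions"
    using prob_algebra_partition_spaceD(2)[OF \<mu>, THEN sets_eq_imp_space_eq]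
    by (simp add: space_partition_space)
  have emeasure_law: "emeasure (law \<delta> \<epsilon> \<mu>' m) B = (\<integral>\<^sup>+R. \<integral>\<^sup>+X. ?b (state m R X) \<partial>?F \<partial>\<mu>')"
    if \<mu>': "\<mu>' \<in> space (prob_algebra partition_space)" for \<mu>' m
  proof -
    have "emeasure (law \<delta> \<epsilon> \<mu>' m) B = (\<integral>\<^sup>+R. ?b R \<partial>law \<delta> \<epsilon> \<mu>' m)"
      by (rule nn_integral_indicator[symmetric]) (simp add: law_def)
    also have "\<dots> = (\<integral>\<^sup>+w. ?b (case w of (R, X) \<Rightarrow> state m R X) \<partial>(\<mu>' \<Otimes>\<^sub>M ?F))"
      unfolding law_def by (rule nn_integral_distr[OF meas[OF \<mu>']]) simp
    also have "\<dots> = (\<integral>\<^sup>+R. \<integral>\<^sup>+X. ?b (state m R X) \<partial>?F \<partial>\<mu>')"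
      using F.nn_integral_fst[of "\<lambda>w. ?b (case w of (R, X) \<Rightarrow> state m R X)" \<mu>']
        measurable_compose[OF meas[OF \<mu>'], of ?b borel] by simp
    finally show ?thesis .
  qed
  \<comment> \<open>The one-step transition probability from \<open>R\<close> into
    \<open>B\<close>.\<close>
  let ?h = "\<lambda>R. \<integral>\<^sup>+Y. ?b (state 1 R Y) \<partial>?F"
  have h: "?h \<in> borel_measurable partition_space"
  proof -
    have "(\<lambda>w. ?b (case w of (R, X) \<Rightarrow> state 1 R X)) \<in> borel_measurable (partition_space \<Otimes>\<^sub>M ?F)"
      by (rule measurable_compose[OF measurable_state]) simp
    from F.borel_measurable_nn_integral_fst[OF this] show ?thesis by simp
  qed
  have "emeasure (law \<delta> \<epsilon> ?L 1) B = (\<integral>\<^sup>+R. \<integral>\<^sup>+Y. ?b (state 1 R Y) \<partial>?F \<partial>?L)"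
    by (rule emeasure_law[OF L])
  also have "\<dots> = (\<integral>\<^sup>+w. ?h (case w of (R, X) \<Rightarrow> state n R X) \<partial>(\<mu> \<Otimes>\<^sub>M ?F))"
    by (subst law_def) (rule nn_integral_distr[OF meas[OF \<mu>]], simp only: measurable_distr_eq1 h)
  also have "\<dots> = (\<integral>\<^sup>+R. \<integral>\<^sup>+X. ?h (state n R X) \<partial>?F \<partial>\<mu>)"
    using F.nn_integral_fst[of "\<lambda>w. ?h (case w of (R, X) \<Rightarrow> state n R X)" \<mu>]
      measurable_compose[OF meas[OF \<mu>] h] by simp
  also have "\<dots> = (\<integral>\<^sup>+R. \<integral>\<^sup>+X. ?b (state (Suc n) R X) \<partial>?F \<partial>\<mu>)"
  proof (rule nn_integral_cong)
    fix R assume "R \<in> space \<mu>"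
    then have R: "R \<in> partitions" by (simp add: space_\<mu>)
    have m: "(\<lambda>X. ?b (state (Suc n) R X)) \<in> borel_measurable ?F"
      by (rule measurable_compose[OF measurable_state_const[OF R]]) simp
    have G: "state (Suc n) R (?G (X, Y)) = state 1 (state n R X) Y" for X Y
    proof -
      have "state n R (?G (X, Y)) = state n R X"
        by (rule state_cong) (simp add: merge_fields_apply vertex_in_verts, simp add: vertex_def)
      moreover have "?G (X, Y) (vertex (Suc n) i) = Y (vertex 1 i)" for i
        by (simp add: merge_fields_apply vertex_in_verts) (simp add: vertex_def)
      ultimately show ?thesis by simp
    qed
    have "(\<integral>\<^sup>+X. ?b (state (Suc n) R X) \<partial>?F)
        = (\<integral>\<^sup>+X. ?b (state (Suc n) R X) \<partial>distr (?F \<Otimes>\<^sub>M ?F) ?F ?G)"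
      by (simp add: distr_merge_fields)
    also have "\<dots> = (\<integral>\<^sup>+w. ?b (state (Suc n) R (?G w)) \<partial>(?F \<Otimes>\<^sub>M ?F))"
      by (rule nn_integral_distr[OF measurable_merge_fields]) (use m in simp)
    also have "\<dots> = (\<integral>\<^sup>+X. \<integral>\<^sup>+Y. ?b (state (Suc n) R (?G (X, Y))) \<partial>?F \<partial>?F)"
      by (rule F.nn_integral_fst[symmetric]) (rule measurable_compose[OF measurable_merge_fields m])
    finally show "(\<integral>\<^sup>+X. \<integral>\<^sup>+Y. ?b (state 1 (state n R X) Y) \<partial>?F \<partial>?F) = (\<integral>\<^sup>+X. ?b (state (Suc n) R X) \<partial>?F)"
      unfolding G by simp
  qed
  also have "\<dots> = emeasure (law \<delta> \<epsilon> \<mu> (Suc n)) B"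
    by (rule emeasure_law[OF \<mu>, symmetric])
  finally show "emeasure (law \<delta> \<epsilon> \<mu> (Suc n)) B = emeasure (law \<delta> \<epsilon> ?L 1) B" ..
qed

text \<open>Appending an independent row to the limit built from \<open>X\<close> gives, almost
  surely, the limit built from a spliced field, which has the law of the original field.\<close>

lemma invariant_stationary_state:
  assumes param: "0 < \<delta>" "\<delta> \<le> 1" "0 < \<epsilon>" "\<epsilon> \<le> 1"
  shows "invariant \<delta> \<epsilon> (distr (symbol_field \<delta> \<epsilon>) partition_space stationary_state)"
proof -
  let ?F = "symbol_field \<delta> \<epsilon>" and ?S = stationary_state
  \<comment> \<open>In the spliced field, \<open>X\<close> from time \<open>0\<close> upwards is
    moved up by one, and row \<open>1\<close> of \<open>Y\<close> takes its place at time
    \<open>0\<close>.\<close>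
  let ?\<nu> = "distr ?F partition_space ?S" and ?G = "merge_fields {v. 1 \<le> snd v} (-1) (-1)"
  interpret F: prob_space ?F by (rule prob_space_symbol_field)
  have \<nu>: "?\<nu> \<in> space (prob_algebra partition_space)"
    by (simp add: space_prob_algebra F.prob_space_distr[OF measurable_stationary_state])
  have step_state: "?S (?G (X, Y)) = state 1 (?S X) Y"
    if X: "\<And>i. \<forall>\<^sub>F n in sequentially. \<not> unerased n i (diagonal_shift (int n) X)" for X Y
  proof
    fix p :: "int \<times> int"
    obtain i j where p: "p = (i, j)" by (cases p)
    let ?W = "\<lambda>n. diagonal_shift (int (Suc n)) (?G (X, Y))" and ?Z = "\<lambda>n. state n discrete_partition (diagonal_shift (int n) X)"
    have W: "?W n (vertex m k) = ?G (X, Y) (2 * k - int m + int (Suc n), int (Suc n) - int m)" for n m k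
      by (rule shift_vertex)
    have verts: "(2 * k - int m + int n, int n - int m) \<in> verts" for k m n
      by (auto simp: verts_def)
    have "state (Suc n) discrete_partition (?W n) = step (?Z n) (\<lambda>k. Y (vertex 1 k))" for n
    proof -
      have "state n discrete_partition (?W n) = ?Z n"
        by (rule state_cong) (simp add: W merge_fields_apply verts shift_vertex del: of_nat_Suc, simp add: algebra_simps)
      moreover have "?W n (vertex (Suc n) k) = Y (vertex 1 k)" for k
        using verts[of k 0 0] by (simp add: W merge_fields_apply del: of_nat_Suc) (simp add: vertex_def)
      ultimately show ?thesis by simp
    qed
    \<comment> \<open>The index shift drops the run of length \<open>0\<close>, which an eventual
      statement does not see.\<close>
    then have "?S (?G (X, Y)) p
        \<longleftrightarrow> (\<forall>\<^sub>F n in sequentially. step (?Z n) (\<lambda>k. Y (vertex 1 k)) (i, j))"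
      unfolding stationary_state_def p
      by (subst eventually_sequentially_Suc[symmetric]) (simp only:)
    also have "\<dots> \<longleftrightarrow> (\<forall>\<^sub>F n :: nat in sequentially. step (?S X) (\<lambda>k. Y (vertex 1 k)) (i, j))"
    proof (rule eventually_cong)
      let ?N = "{i - 1, i, j - 1, j}"
      \<comment> \<open>Finitely many coordinates stabilize simultaneously, which is what
        \<open>step_cong\<close> asks for.\<close>
      show "\<forall>\<^sub>F n in sequentially. \<forall>q\<in>?N \<times> ?N. ?Z n q = ?S X q"
        by (intro eventually_ball_finite ballI
            eventually_state_eq_stationary_state[OF X discrete_partition_in_partitions]) auto
      show "step (?Z n) (\<lambda>k. Y (vertex 1 k)) (i, j) \<longleftrightarrow> step (?S X) (\<lambda>k. Y (vertex 1 k)) (i, j)"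
        if "\<forall>q\<in>?N \<times> ?N. ?Z n q = ?S X q" for n
        using that by (intro step_cong state_in_partitions discrete_partition_in_partitions
            stationary_state_in_partitions) auto
    qed
    finally show "?S (?G (X, Y)) p = state 1 (?S X) Y p"
      by (simp add: p)
  qed
  have "?\<nu> \<Otimes>\<^sub>M distr ?F ?F (\<lambda>Y. Y)
      = distr (?F \<Otimes>\<^sub>M ?F) (partition_space \<Otimes>\<^sub>M ?F) (\<lambda>(X, Y). (?S X, Y))"
    by (rule pair_measure_distr) (simp_all add: F.sigma_finite_measure_axioms)
  then have "law \<delta> \<epsilon> ?\<nu> 1 = distr (distr (?F \<Otimes>\<^sub>M ?F) (partition_space \<Otimes>\<^sub>M ?F) (\<lambda>(X, Y). (?S X, Y)))
      partition_space (\<lambda>(R, X). state 1 R X)"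
    by (simp add: law_def)
  also have "\<dots> = distr (?F \<Otimes>\<^sub>M ?F) partition_space ((\<lambda>(R, X). state 1 R X) \<circ> (\<lambda>(X, Y). (?S X, Y)))"
    by (rule distr_distr[OF measurable_state]) measurable
  also have "\<dots> = distr (?F \<Otimes>\<^sub>M ?F) partition_space (\<lambda>w. ?S (?G w))"
  proof (rule distr_cong_AE)
    have "AE X in distr (?F \<Otimes>\<^sub>M ?F) ?F fst. \<forall>i. \<forall>\<^sub>F n in sequentially. \<not> unerased n i (diagonal_shift (int n) X)"
      unfolding F.distr_pair_fst by (rule AE_eventually_erased[OF param])
    then have "AE w in ?F \<Otimes>\<^sub>M ?F. \<forall>i. \<forall>\<^sub>F n in sequentially. \<not> unerased n i (diagonal_shift (int n) (fst w))"
      by (rule AE_distrD[OF measurable_fst])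
    then show "AE w in ?F \<Otimes>\<^sub>M ?F. ((\<lambda>(R, X). state 1 R X) \<circ> (\<lambda>(X, Y). (?S X, Y))) w = ?S (?G w)"
      by eventually_elim (auto simp: step_state simp del: state.simps One_nat_def)
    show "(\<lambda>(R, X). state 1 R X) \<circ> (\<lambda>(X, Y). (?S X, Y)) \<in> ?F \<Otimes>\<^sub>M ?F \<rightarrow>\<^sub>M partition_space"
      by (rule measurable_comp[OF _ measurable_state]) measurable
  qed simp_all
  also have "\<dots> = distr (distr (?F \<Otimes>\<^sub>M ?F) ?F ?G) partition_space ?S"
    by (subst distr_distr) (simp_all add: comp_def)
  finally show ?thesis
    using \<nu> by (simp add: invariant_def distr_merge_fields)
qed

text \<open>Coordinates take values in a discrete space, so indicators of finite cylinders are
  continuous, and finite cylinders determine a probability measure.\<close>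

lemma partition_measure_eqI:
  assumes \<mu>: "\<mu> \<in> space (prob_algebra partition_space)" and \<nu>: "\<nu> \<in> space (prob_algebra partition_space)"
    and eq: "\<And>f :: rel01 \<Rightarrow> real. continuous_on partitions f \<Longrightarrow> bounded (f ` partitions) \<Longrightarrow>
      (\<integral>R. f R \<partial>\<mu>) = (\<integral>R. f R \<partial>\<nu>)"
  shows "\<mu> = \<nu>"
proof -
  have incl: "(\<lambda>R. R) \<in> \<mu>' \<rightarrow>\<^sub>M borel" "space \<mu>' = partitions" "prob_space \<mu>'" "sets \<mu>' = sets partition_space"
    if \<mu>': "\<mu>' \<in> space (prob_algebra partition_space)" for \<mu>' :: "rel01 measure"
  proof -
    show sets: "sets \<mu>' = sets partition_space" and "prob_space \<mu>'"
      using prob_algebra_partition_spaceD[OF \<mu>'] by auto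
    show "space \<mu>' = partitions"
      using sets_eq_imp_space_eq[OF sets] by (simp add: space_partition_space)
    show "(\<lambda>R. R) \<in> \<mu>' \<rightarrow>\<^sub>M borel"
      unfolding measurable_cong_sets[OF sets refl] partition_space_def
      by (rule measurable_restrict_space1) simp
  qed
  \<comment> \<open>Both measures are pushed to the full function space, where uniqueness on
    cylinders applies, and are restricted to \<open>partitions\<close> afterwards.\<close>
  have "distr \<mu> borel (\<lambda>R. R) = distr \<nu> borel (\<lambda>R. R)"
  proof (rule measure_eqI_PiM_infinite[where I = UNIV and M = "\<lambda>_. borel"])
    fix J :: "(int \<times> int) set" and A :: "int \<times> int \<Rightarrow> bool set"
    assume J: "finite J" and A: "\<And>p. p \<in> J \<Longrightarrow> A p \<in> sets borel"
    let ?C = "prod_emb UNIV (\<lambda>_. borel) J (Pi\<^sub>E J A)" and ?f = "\<lambda>R :: rel01. \<Prod>p\<in>J. (indicator (A p) (R p) :: real)"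
    have C: "?C = {R. \<forall>p\<in>J. R p \<in> A p}"
      by (auto simp: prod_emb_def PiE_iff)
    have f: "?f = indicator ?C"
      using J by (auto simp: C fun_eq_iff indicator_def prod_eq_1_iff)
    have "continuous_on UNIV (\<lambda>R :: rel01. (indicator (A p) (R p) :: real))" for p
      by (rule continuous_on_compose2[OF _ continuous_on_product_coordinates, of UNIV]) auto
    then have "continuous_on UNIV ?f"
      by (intro continuous_on_prod) auto
    then have "continuous_on partitions ?f"
      by (rule continuous_on_subset) simp
    moreover have "bounded (?f ` partitions)"
      unfolding f by (rule boundedI[of _ 1]) (auto simp: indicator_def)
    ultimately have int: "(\<integral>R. ?f R \<partial>\<mu>) = (\<integral>R. ?f R \<partial>\<nu>)"
      by (rule eq)
    have C_meas: "?C \<in> sets borel"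
      using sets_PiM_I[of J UNIV A "\<lambda>_. borel :: bool measure"] J A
      by (simp add: sets_PiM_equal_borel)
    have "emeasure (distr \<mu>' borel (\<lambda>R. R)) ?C = ennreal (\<integral>R. ?f R \<partial>\<mu>')"
      if "\<mu>' \<in> space (prob_algebra partition_space)" for \<mu>'
    proof -
      note i = incl[OF that]
      interpret prob_space \<mu>' by (rule i)
      have "?C \<inter> space \<mu>' \<in> sets \<mu>'"
        using measurable_sets[OF i(1) C_meas] by simp
      then have "(\<integral>R. ?f R \<partial>\<mu>') = prob (?C \<inter> space \<mu>')"
        by (simp add: f)
      then show ?thesis
        using C_meas i by (simp add: emeasure_distr emeasure_eq_measure)
    qed
    then show "emeasure (distr \<mu> borel (\<lambda>R. R)) ?C = emeasure (distr \<nu> borel (\<lambda>R. R)) ?C"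
      using \<mu> \<nu> int by simp
  next
    show "finite_measure (distr \<mu> borel (\<lambda>R. R))"
      using prob_space.prob_space_distr[OF incl(3)[OF \<mu>] incl(1)[OF \<mu>]] by (simp add: prob_space_def)
  qed (simp_all add: sets_PiM_equal_borel)
  moreover have "emeasure \<mu>' (B \<inter> partitions) = emeasure (distr \<mu>' borel (\<lambda>R. R)) B"
    if "\<mu>' \<in> space (prob_algebra partition_space)" "B \<in> sets borel" for \<mu>' B
    using incl[OF that(1)] that(2) by (simp add: emeasure_distr)
  ultimately have "emeasure \<mu> (B \<inter> partitions) = emeasure \<nu> (B \<inter> partitions)" if "B \<in> sets borel" for B
    using \<mu> \<nu> that by metis
  then show ?thesis
    using incl(4)[OF \<mu>] incl(4)[OF \<nu>]
    by (intro measure_eqI) (auto simp: partition_space_def sets_restrict_space Int_commute)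
qed

theorem theorem4:
  fixes \<delta> \<epsilon> :: real
  assumes "0 < \<delta>" "\<delta> \<le> 1" "0 < \<epsilon>" "\<epsilon> \<le> 1"
  shows "ergodic \<delta> \<epsilon>"
proof -
  let ?\<nu> = "distr (symbol_field \<delta> \<epsilon>) partition_space stationary_state"
  have inv: "invariant \<delta> \<epsilon> ?\<nu>"
    using assms by (rule invariant_stationary_state)
  have conv: "weakly_converges (law \<delta> \<epsilon> \<mu>) ?\<nu>" if "\<mu> \<in> space (prob_algebra partition_space)" for \<mu>
    using assms that by (rule weakly_converges_law)
  have "\<nu>' = ?\<nu>" if "invariant \<delta> \<epsilon> \<nu>'" for \<nu>'
  proof (rule partition_measure_eqI)
    show \<nu>': "\<nu>' \<in> space (prob_algebra partition_space)"
      using that by (simp add: invariant_def)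
    show "?\<nu> \<in> space (prob_algebra partition_space)"
      using inv by (simp add: invariant_def)
    \<comment> \<open>The laws started from \<open>\<nu>'\<close> are constant, so their weak limit
      is \<open>\<nu>'\<close> itself. Beginning at \<open>Suc n\<close> makes invariance the base
      case.\<close>
    have "law \<delta> \<epsilon> \<nu>' (Suc n) = \<nu>'" for n
      using that by (induction n) (simp_all add: invariant_def law_Suc[OF \<nu>', of _ _ "Suc _"])
    then show "(\<integral>R. f R \<partial>\<nu>') = (\<integral>R. f R \<partial>?\<nu>)"
      if "continuous_on partitions f" "bounded (f ` partitions)" for f :: "rel01 \<Rightarrow> real"
      using conv[OF \<nu>'] that LIMSEQ_unique[OF tendsto_const]
        LIMSEQ_Suc[of "\<lambda>n. \<integral>R. f R \<partial>law \<delta> \<epsilon> \<nu>' n"]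
      by (fastforce simp: weakly_converges_def)
  qed
  with inv conv show ?thesis
    unfolding ergodic_def by blast
qed

end
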